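(* Fix $\widehat{c}_n\in[0,1]$ for all $n\in\mathcal{N}$. Let $\mathbf{p}^{\mathrm{u}}=(p_1^{\mathrm{u}},\dots,p_N^{\mathrm{u}})$ be a fixed power vector with $0\le p_n^{\mathrm{u}}\le P_{\max}^{\mathrm{u}}$ for all $n\in\mathcal{N}$, for which the following problem in the nonzero receive beamformers $\mathbf{w}=(\mathbf{w}_1,\dots,\mathbf{w}_N)$, $\mathbf{w}_n\in\mathbb{C}^{L}\setminus\{\mathbf{0}\}$, is feasible: $$\min_{\mathbf{w}}\ \sum_{n=1}^N p_n^{\mathrm{u}}\,T_n^{\mathrm{a}}(\mathbf{p}^{\mathrm{u}},\mathbf{w}_n)\quad\text{s.t.}\quad T_n^{\mathrm{a}}(\mathbf{p}^{\mathrm{u}},\mathbf{w}_n)+\widehat{c}_n T_n^{\mathrm{edge}}\le T_{\mathrm{th}}\quad\forall n\in\mathcal{N}.$$ Then an optimal solution $\mathbf{w}^*=(\mathbf{w}_1^*,\dots,\mathbf{w}_N^* )$ is given by taking, for each $n\in\mathcal{N}$, $\mathbf{w}_n^*$ to be an eigenvector associated with the largest eigenvalue of the matrix $(\mathbf{\Omega}_{-n})^{-1}\mathbf{\Omega}_n$, where $$\mathbf{\Omega}_{-n}=\sigma_n^2\mathbf{I}_L+\sum_{i=1,\,i\ne n}^N p_i^{\mathrm{u}}\,\mathbf{h}_{i,n}^{\mathrm{a}}(\mathbf{h}_{i,n}^{\mathrm{a}})^H,\qquad \mathbf{\Omega}_n=p_n^{\mathrm{u}}\,\mathbf{h}_{n,n}^{\mathrm{a}}(\mathbf{h}_{n,n}^{\mathrm{a}})^H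 .$$
   Context: $\mathcal{N}=\{1,\dots,N\}$; $L\ge1$ is an integer. The constants $B^{\mathrm{a}},I_n,\sigma_n^2,P_{\max}^{\mathrm{u}},T_{\mathrm{th}},T_n^{\mathrm{edge}}$ are positive reals. The channel vectors $\mathbf{h}_{i,n}^{\mathrm{a}}\in\mathbb{C}^{L}$ ($i,n\in\mathcal{N}$) are given. $(\cdot)^H$ denotes conjugate transpose. For a power vector $\mathbf{p}^{\mathrm{u}}$ and a nonzero $\mathbf{w}_n\in\mathbb{C}^L$, the SINR is $$\gamma_n^{\mathrm{a}}(\mathbf{p}^{\mathrm{u}},\mathbf{w}_n)=\frac{p_n^{\mathrm{u}}|\mathbf{w}_n^H\mathbf{h}_{n,n}^{\mathrm{a}}|^2}{\sum_{i=1,i\ne n}^N p_i^{\mathrm{u}}|\mathbf{w}_n^H\mathbf{h}_{i,n}^{\mathrm{a}}|^2+\sigma_n^2\|\mathbf{w}_n\|^2},$$ the rate is $R_n^{\mathrm{a}}(\mathbf{p}^{\mathrm{u}},\mathbf{w}_n)=B^{\mathrm{a}}\log_2(1+\gamma_n^{\mathrm{a}}(\mathbf{p}^{\mathrm{u}},\mathbf{w}_n))$, and the transmission latency is $T_n^{\mathrm{a}}(\mathbf{p}^{\mathrm{u}},\mathbf{w}_n)=I_n/R_n^{\mathrm{a}}(\mathbf{p}^{\mathrm{u}},\mathbf{w}_n)$, understood as $+\infty$ if the rate is $0$ (so the latency constraint then fails). *)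

theory Defs
  imports "HOL-Analysis.Analysis"
begin

text \<open>
  Users are indexed by a finite type \<open>'n\<close> (so \<open>N = CARD('n)\<close>) and antennas by a finite type \<open>'l\<close>
  (so \<open>L = CARD('l)\<close>).  \<open>h i n\<close> is the channel vector from user \<open>i\<close> to the receiver of user \<open>n\<close>,
  and \<open>s2 n\<close> is the noise power \<open>\<sigma>\<^sub>n\<^sup>2\<close> itself, not its square root.
\<close>

text \<open>\<open>u\<^sup>H v\<close>; the library's inner product on \<open>complex ^ 'l\<close> is the real one, hence unsuitable here.\<close>

definition herm_prod :: "complex ^ 'l::finite \<Rightarrow> complex ^ 'l \<Rightarrow> complex" where
  "herm_prod u v = (\<Sum>j\<in>UNIV. cnj (u $ j) * v $ j)"

text \<open>\<open>u v\<^sup>H\<close>\<close>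

definition outer_prod :: "complex ^ 'l::finite \<Rightarrow> complex ^ 'l \<Rightarrow> complex ^ 'l ^ 'l" where
  "outer_prod u v = (\<chi> i j. u $ i * cnj (v $ j))"

definition eigenvector :: "complex ^ 'l ^ 'l::finite \<Rightarrow> complex ^ 'l \<Rightarrow> complex \<Rightarrow> bool" where
  "eigenvector A v k \<longleftrightarrow> v \<noteq> 0 \<and> A *v v = k *s v"

definition eigenvalue :: "complex ^ 'l ^ 'l::finite \<Rightarrow> complex \<Rightarrow> bool" where
  "eigenvalue A k \<longleftrightarrow> (\<exists>v. eigenvector A v k)"

text \<open>A largest eigenvalue is only meaningful for matrices with real spectrum, so that is part of
  the notion; the matrices it is applied to need not be Hermitian.\<close>

definition largest_eigenvalue :: "complex ^ 'l ^ 'l::finite \<Rightarrow> real \<Rightarrow> bool" where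
  "largest_eigenvalue A r \<longleftrightarrow>
     eigenvalue A (complex_of_real r) \<and> (\<forall>k. eigenvalue A k \<longrightarrow> k \<in> \<real> \<and> Re k \<le> r)"

definition principal_eigenvector :: "complex ^ 'l ^ 'l::finite \<Rightarrow> complex ^ 'l \<Rightarrow> bool" where
  "principal_eigenvector A v \<longleftrightarrow>
     (\<exists>r. largest_eigenvalue A r \<and> eigenvector A v (complex_of_real r))"

definition sinr ::
  "('n::finite \<Rightarrow> 'n \<Rightarrow> complex ^ 'l::finite) \<Rightarrow> ('n \<Rightarrow> real) \<Rightarrow> ('n \<Rightarrow> real) \<Rightarrow> 'n \<Rightarrow> complex ^ 'l \<Rightarrow> real"
where
  "sinr h s2 p n v =
     p n * (cmod (herm_prod v (h n n)))\<^sup>2 /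
     ((\<Sum>i\<in>UNIV - {n}. p i * (cmod (herm_prod v (h i n)))\<^sup>2) + s2 n * (norm v)\<^sup>2)"

definition rate ::
  "real \<Rightarrow> ('n::finite \<Rightarrow> 'n \<Rightarrow> complex ^ 'l::finite) \<Rightarrow> ('n \<Rightarrow> real) \<Rightarrow> ('n \<Rightarrow> real) \<Rightarrow> 'n \<Rightarrow>
     complex ^ 'l \<Rightarrow> real"
where
  "rate B h s2 p n v = B * log 2 (1 + sinr h s2 p n v)"

definition latency ::
  "real \<Rightarrow> ('n::finite \<Rightarrow> real) \<Rightarrow> ('n \<Rightarrow> 'n \<Rightarrow> complex ^ 'l::finite) \<Rightarrow> ('n \<Rightarrow> real) \<Rightarrow> ('n \<Rightarrow> real) \<Rightarrow>
     'n \<Rightarrow> complex ^ 'l \<Rightarrow> ereal"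
where
  "latency B D h s2 p n v =
     (if rate B h s2 p n v = 0 then \<infinity> else ereal (D n / rate B h s2 p n v))"

definition energy ::
  "real \<Rightarrow> ('n::finite \<Rightarrow> real) \<Rightarrow> ('n \<Rightarrow> 'n \<Rightarrow> complex ^ 'l::finite) \<Rightarrow> ('n \<Rightarrow> real) \<Rightarrow> ('n \<Rightarrow> real) \<Rightarrow>
     ('n \<Rightarrow> complex ^ 'l) \<Rightarrow> ereal"
where
  "energy B D h s2 p w = (\<Sum>n\<in>UNIV. ereal (p n) * latency B D h s2 p n (w n))"

definition feasible ::
  "real \<Rightarrow> ('n::finite \<Rightarrow> real) \<Rightarrow> ('n \<Rightarrow> 'n \<Rightarrow> complex ^ 'l::finite) \<Rightarrow> ('n \<Rightarrow> real) \<Rightarrow>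
     ('n \<Rightarrow> real) \<Rightarrow> ('n \<Rightarrow> real) \<Rightarrow> real \<Rightarrow> ('n \<Rightarrow> real) \<Rightarrow> ('n \<Rightarrow> complex ^ 'l) \<Rightarrow> bool"
where
  "feasible B D h s2 c Tedge Tth p w \<longleftrightarrow>
     (\<forall>n. w n \<noteq> 0 \<and> latency B D h s2 p n (w n) + ereal (c n * Tedge n) \<le> ereal Tth)"

definition optimal ::
  "real \<Rightarrow> ('n::finite \<Rightarrow> real) \<Rightarrow> ('n \<Rightarrow> 'n \<Rightarrow> complex ^ 'l::finite) \<Rightarrow> ('n \<Rightarrow> real) \<Rightarrow>
     ('n \<Rightarrow> real) \<Rightarrow> ('n \<Rightarrow> real) \<Rightarrow> real \<Rightarrow> ('n \<Rightarrow> real) \<Rightarrow> ('n \<Rightarrow> complex ^ 'l) \<Rightarrow> bool"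
where
  "optimal B D h s2 c Tedge Tth p w \<longleftrightarrow>
     feasible B D h s2 c Tedge Tth p w \<and>
     (\<forall>w'. feasible B D h s2 c Tedge Tth p w' \<longrightarrow> energy B D h s2 p w \<le> energy B D h s2 p w')"

definition Omega_minus ::
  "('n::finite \<Rightarrow> 'n \<Rightarrow> complex ^ 'l::finite) \<Rightarrow> ('n \<Rightarrow> real) \<Rightarrow> ('n \<Rightarrow> real) \<Rightarrow> 'n \<Rightarrow> complex ^ 'l ^ 'l"
where
  "Omega_minus h s2 p n =
     s2 n *\<^sub>R mat 1 + (\<Sum>i\<in>UNIV - {n}. p i *\<^sub>R outer_prod (h i n) (h i n))"

definition Omega ::
  "('n::finite \<Rightarrow> 'n \<Rightarrow> complex ^ 'l::finite) \<Rightarrow> ('n \<Rightarrow> real) \<Rightarrow> 'n \<Rightarrow> complex ^ 'l ^ 'l"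
where
  "Omega h p n = p n *\<^sub>R outer_prod (h n n) (h n n)"

end

theory Submission
  imports Defs
begin

text \<open>
  Write \<open>A\<close> for \<open>\<Omega>\<^sub>-\<^sub>n\<close>, \<open>g\<close> for \<open>h\<^sub>n\<^sub>,\<^sub>n\<close> and \<open>q\<close> for \<open>p\<^sub>n\<close>. The matrix \<open>A\<close> is Hermitian positive definite and
  the SINR is the generalized Rayleigh quotient \<open>q |v\<^sup>H g|\<^sup>2 / (v\<^sup>H A v)\<close>. An eigenvector \<open>w\<close> with eigenvalue
  \<open>r\<close> satisfies \<open>r A w = q (g\<^sup>H w) g\<close>. Pairing with \<open>w\<close> shows that its SINR is \<open>r\<close>; pairing with an
  arbitrary \<open>v\<close> and applying Cauchy--Schwarz for \<open>A\<close> bounds the SINR of \<open>v\<close> by \<open>r\<close> whenever \<open>r > 0\<close>.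
  Feasibility forces \<open>q > 0\<close> and \<open>g \<noteq> 0\<close>, so \<open>A\<^sup>-\<^sup>1 g\<close> is an eigenvector with positive eigenvalue.
  Latency is decreasing in the SINR, hence the problem decouples over the users.
\<close>

section \<open>Algebra of the Hermitian product and of rank-one matrices\<close>

lemma herm_prod_add_right: "herm_prod u (v + w) = herm_prod u v + herm_prod u w"
  by (simp add: herm_prod_def algebra_simps sum.distrib)

lemma herm_prod_diff_right: "herm_prod u (v - w) = herm_prod u v - herm_prod u w"
  by (simp add: herm_prod_def algebra_simps sum_subtractf)

lemma herm_prod_diff_left: "herm_prod (u - v) w = herm_prod u w - herm_prod v w"
  by (simp add: herm_prod_def algebra_simps sum_subtractf)

lemma herm_prod_smult_right: "herm_prod u (k *s v) = k * herm_prod u v"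
  by (simp add: herm_prod_def algebra_simps sum_distrib_left)

lemma herm_prod_smult_left: "herm_prod (k *s u) v = cnj k * herm_prod u v"
  by (simp add: herm_prod_def algebra_simps sum_distrib_left)

lemma herm_prod_scaleR_right: "herm_prod u (r *\<^sub>R v) = of_real r * herm_prod u v"
  unfolding herm_prod_def vector_scaleR_component
  by (simp add: algebra_simps sum_distrib_left scaleR_conv_of_real)

lemma herm_prod_zero_right [simp]: "herm_prod u 0 = 0"
  by (simp add: herm_prod_def)

lemma herm_prod_zero_left [simp]: "herm_prod 0 u = 0"
  by (simp add: herm_prod_def)

lemma herm_prod_sum_right: "herm_prod u (\<Sum>i\<in>S. f i) = (\<Sum>i\<in>S. herm_prod u (f i))"
  by (induction S rule: infinite_finite_induct) (simp_all add: herm_prod_add_right)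

lemma cnj_herm_prod: "cnj (herm_prod u v) = herm_prod v u"
  by (simp add: herm_prod_def mult.commute)

lemma herm_prod_mult_swap: "herm_prod u v * herm_prod v u = of_real ((cmod (herm_prod u v))\<^sup>2)"
  by (metis cnj_herm_prod complex_norm_square)

lemma herm_prod_self: "herm_prod v v = of_real ((norm v)\<^sup>2)"
proof -
  have "herm_prod v v = (\<Sum>j\<in>UNIV. of_real ((cmod (v $ j))\<^sup>2))"
    unfolding herm_prod_def by (intro sum.cong refl) (simp only: complex_norm_square mult.commute)
  then show ?thesis
    by (simp add: norm_vec_def L2_set_def sum_nonneg)
qed

lemma outer_prod_mult_vec: "outer_prod u v *v x = herm_prod v x *s u"
  by (simp add: vec_eq_iff outer_prod_def matrix_vector_mult_def herm_prod_def
      sum_distrib_left sum_distrib_right algebra_simps)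

lemma scaleR_mult_vec: "(r *\<^sub>R A) *v (x :: complex ^ 'n::finite) = r *\<^sub>R (A *v x)"
  by (simp add: vec_eq_iff matrix_vector_mult_def scaleR_sum_right)

lemma sum_mult_vec: "(\<Sum>i\<in>S. f i) *v (x :: complex ^ 'n::finite) = (\<Sum>i\<in>S. f i *v x)"
  by (induction S rule: infinite_finite_induct) (simp_all add: matrix_vector_mult_add_rdistrib)

lemma matrix_inv_inverse:
  assumes "invertible A"
  shows "A ** matrix_inv A = mat 1" "matrix_inv A ** A = mat 1"
  using someI_ex[OF assms[unfolded invertible_def]] by (auto simp: matrix_inv_def)

text \<open>Expand the nonnegative form at \<open>v - t *s w\<close>, the residual of projecting
  \<open>v\<close> onto \<open>w\<close>. Semidefiniteness suffices, with positivity only at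
  \<open>w\<close>, where a division takes place.\<close>

lemma herm_prod_Cauchy_Schwarz:
  fixes A :: "complex ^ 'l::finite ^ 'l"
  assumes herm: "\<And>u v. cnj (herm_prod u (A *v v)) = herm_prod v (A *v u)"
    and psd: "\<And>u. 0 \<le> Re (herm_prod u (A *v u))"
    and pos: "0 < Re (herm_prod w (A *v w))"
  shows "(cmod (herm_prod v (A *v w)))\<^sup>2 \<le> Re (herm_prod v (A *v v)) * Re (herm_prod w (A *v w))"
proof -
  define a where "a = Re (herm_prod w (A *v w))"
  define b where "b = herm_prod v (A *v w)"
  \<comment> \<open>The projection coefficient of \<open>v\<close> along \<open>w\<close> with
    respect to the form of \<open>A\<close>.\<close>
  define t where "t = cnj b / of_real a"
  have a: "herm_prod w (A *v w) = of_real a"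
    using herm[of w w] by (simp add: complex_eq_iff a_def)
  have bb: "herm_prod w (A *v v) = cnj b"
    by (simp add: b_def herm)
  have "a > 0" using pos by (simp add: a_def)
  have "herm_prod (v - t *s w) (A *v (v - t *s w))
      = herm_prod v (A *v v) - t * b - cnj t * cnj b + cnj t * t * of_real a"
    by (simp add: matrix_vector_mult_diff_distrib vector_scalar_commute herm_prod_diff_left
        herm_prod_diff_right herm_prod_smult_left herm_prod_smult_right a bb flip: b_def)
       (simp add: algebra_simps)
  also have "\<dots> = herm_prod v (A *v v) - of_real ((cmod b)\<^sup>2 / a)"
    using \<open>a > 0\<close> by (simp add: t_def complex_norm_square field_simps del: of_real_power)
  finally have "0 \<le> Re (herm_prod v (A *v v)) - (cmod b)\<^sup>2 / a"
    using psd[of "v - t *s w"] by simp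
  then show ?thesis
    using \<open>a > 0\<close> by (simp add: field_simps flip: a_def b_def)
qed

section \<open>\<open>Omega_minus\<close> as a Hermitian form, and the spectrum of the matrix
  product\<close>

definition interference ::
  "('n::finite \<Rightarrow> 'n \<Rightarrow> complex ^ 'l::finite) \<Rightarrow> ('n \<Rightarrow> real) \<Rightarrow> ('n \<Rightarrow> real) \<Rightarrow> 'n \<Rightarrow> complex ^ 'l \<Rightarrow> real"
where
  "interference h s2 p n v =
     (\<Sum>i\<in>UNIV - {n}. p i * (cmod (herm_prod v (h i n)))\<^sup>2) + s2 n * (norm v)\<^sup>2"

lemma sinr_eq_quotient:
  "sinr h s2 p n v = p n * (cmod (herm_prod v (h n n)))\<^sup>2 / interference h s2 p n v"
  by (simp add: sinr_def interference_def)

lemma interference_pos: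
  assumes "s2 n > 0" "\<And>i. 0 \<le> p i" "v \<noteq> 0"
  shows "interference h s2 p n v > 0"
  unfolding interference_def using assms by (intro add_nonneg_pos sum_nonneg) auto

text \<open>Each rank-one term contributes a product of two Hermitian products; symmetry and the
  diagonal values are read off from this.\<close>

lemma Omega_minus_form:
  "herm_prod u (Omega_minus h s2 p n *v v) = of_real (s2 n) * herm_prod u v
     + (\<Sum>i\<in>UNIV - {n}. of_real (p i) * (herm_prod u (h i n) * herm_prod (h i n) v))"
  by (simp add: Omega_minus_def matrix_vector_mult_add_rdistrib scaleR_mult_vec sum_mult_vec
      outer_prod_mult_vec herm_prod_add_right herm_prod_scaleR_right herm_prod_sum_right
      herm_prod_smult_right mult_ac)

lemma Omega_minus_hermitian:
  "cnj (herm_prod u (Omega_minus h s2 p n *v v)) = herm_prod v (Omega_minus h s2 p n *v u)"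
  by (simp add: Omega_minus_form cnj_herm_prod mult_ac)

lemma Omega_minus_diag:
  "herm_prod v (Omega_minus h s2 p n *v v) = of_real (interference h s2 p n v)"
  by (simp add: Omega_minus_form interference_def herm_prod_mult_swap herm_prod_self)

lemma Omega_mult_vec: "Omega h p n *v v = (of_real (p n) * herm_prod (h n n) v) *s h n n"
  by (simp add: Omega_def scaleR_mult_vec outer_prod_mult_vec vec_eq_iff) (simp add: scaleR_conv_of_real)

text \<open>The form is positive at nonzero vectors, so the kernel is trivial.\<close>

lemma invertible_Omega_minus:
  assumes "s2 n > 0" "\<And>i. 0 \<le> p i"
  shows "invertible (Omega_minus h s2 p n)"
proof -
  have "v = 0" if "Omega_minus h s2 p n *v v = 0" for v
    using Omega_minus_diag[of v h s2 p n] interference_pos[of s2 n p v h] that assms by fastforce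
  then show ?thesis
    by (simp add: invertible_left_inverse matrix_left_invertible_ker)
qed

text \<open>Multiplying by \<open>Omega_minus\<close> or its inverse passes between the two
  equations. The inverse-free one can be paired with any vector.\<close>

lemma eigenvector_Omega_iff:
  assumes "invertible (Omega_minus h s2 p n)"
  shows "eigenvector (matrix_inv (Omega_minus h s2 p n) ** Omega h p n) w k \<longleftrightarrow>
    w \<noteq> 0 \<and> k *s (Omega_minus h s2 p n *v w) = (of_real (p n) * herm_prod (h n n) w) *s h n n"
    (is "eigenvector (?B ** _) w k \<longleftrightarrow> _ \<and> k *s (?A *v w) = ?y")
proof -
  have inv: "?A ** ?B = mat 1" "?B ** ?A = mat 1"
    using matrix_inv_inverse[OF assms] by auto
  have "?B *v ?y = k *s w \<longleftrightarrow> k *s (?A *v w) = ?y"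
    by (metis inv matrix_vector_mul_assoc matrix_vector_mul_lid vector_scalar_commute)
  then show ?thesis
    by (simp add: eigenvector_def Omega_mult_vec flip: matrix_vector_mul_assoc)
qed

text \<open>Pairing with \<open>w\<close> makes both sides real apart from \<open>k\<close>, so the
  spectrum is real although the product need not be Hermitian.\<close>

lemma eigenvalue_eq_sinr:
  assumes "s2 n > 0" "\<And>i. 0 \<le> p i"
    and "eigenvector (matrix_inv (Omega_minus h s2 p n) ** Omega h p n) w k"
  shows "k = of_real (sinr h s2 p n w)"
proof -
  have "w \<noteq> 0" and eq: "k *s (Omega_minus h s2 p n *v w) = (of_real (p n) * herm_prod (h n n) w) *s h n n"
    using assms eigenvector_Omega_iff[OF invertible_Omega_minus] by blast+
  have "k * of_real (interference h s2 p n w) = of_real (p n * (cmod (herm_prod w (h n n)))\<^sup>2)"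
    using arg_cong[OF eq, of "herm_prod w"] herm_prod_mult_swap[of w "h n n"]
    by (simp add: herm_prod_smult_right Omega_minus_diag mult_ac)
  moreover have "interference h s2 p n w > 0"
    using assms \<open>w \<noteq> 0\<close> by (intro interference_pos)
  ultimately show ?thesis
    by (simp add: sinr_eq_quotient field_simps)
qed

lemma sinr_le_eigenvalue:
  assumes "s2 n > 0" "\<And>i. 0 \<le> p i" "v \<noteq> 0" "r > 0"
    and ev: "eigenvector (matrix_inv (Omega_minus h s2 p n) ** Omega h p n) w (of_real r)"
  shows "sinr h s2 p n v \<le> r"
proof -
  let ?A = "Omega_minus h s2 p n" and ?I = "interference h s2 p n" and ?g = "h n n"
  have "w \<noteq> 0" and eq: "of_real r *s (?A *v w) = (of_real (p n) * herm_prod ?g w) *s ?g"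
    using assms eigenvector_Omega_iff[OF invertible_Omega_minus] by blast+
  have Iw: "?I w > 0" and Iv: "?I v > 0"
    using assms \<open>w \<noteq> 0\<close> by (auto intro!: interference_pos)
  have nonneg: "0 \<le> Re (herm_prod u (?A *v u))" for u
    using interference_pos[of s2 n p u h] assms by (cases "u = 0") (force simp: Omega_minus_diag)+
  have "r = sinr h s2 p n w"
    using eigenvalue_eq_sinr[OF assms(1,2) ev] of_real_eq_iff by blast
  then have rw: "r * ?I w = p n * (cmod (herm_prod ?g w))\<^sup>2"
    using Iw complex_mod_cnj[of "herm_prod w ?g"] by (simp add: sinr_eq_quotient cnj_herm_prod)
  have "r * cmod (herm_prod v (?A *v w)) = p n * cmod (herm_prod ?g w) * cmod (herm_prod v ?g)"
    using arg_cong[OF eq, of "\<lambda>x. cmod (herm_prod v x)"] assms(2)[of n] \<open>r > 0\<close>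
    by (simp add: herm_prod_smult_right norm_mult)
  \<comment> \<open>By \<open>rw\<close>, part of the squared right-hand side is
    \<open>r * ?I w\<close>, a factor that the Cauchy-Schwarz bound also contains and that cancels
    because \<open>r > 0\<close>.\<close>
  then have "r\<^sup>2 * (cmod (herm_prod v (?A *v w)))\<^sup>2
      = (r * ?I w) * (p n * (cmod (herm_prod v ?g))\<^sup>2)"
    unfolding rw power_mult_distrib[symmetric] by (simp add: power2_eq_square mult_ac)
  moreover have "(cmod (herm_prod v (?A *v w)))\<^sup>2 \<le> ?I v * ?I w"
    using herm_prod_Cauchy_Schwarz[OF Omega_minus_hermitian nonneg, of w v] Iw
    by (simp add: Omega_minus_diag)
  ultimately have "(r * ?I w) * (p n * (cmod (herm_prod v ?g))\<^sup>2) \<le> r\<^sup>2 * (?I v * ?I w)"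
    by (metis mult_left_mono zero_le_power2)
  also have "\<dots> = (r * ?I w) * (r * ?I v)"
    by (simp add: power2_eq_square)
  finally have "p n * (cmod (herm_prod v ?g))\<^sup>2 \<le> r * ?I v"
    using \<open>r > 0\<close> Iw by simp
  then show ?thesis
    using Iv by (simp add: sinr_eq_quotient divide_le_eq)
qed

text \<open>The range of \<open>Omega\<close> is spanned by \<open>h n n\<close>, so the preimage of
  \<open>h n n\<close> under \<open>Omega_minus\<close> gives the only direction that can have a
  nonzero eigenvalue.\<close>

lemma ex_positive_eigenvalue:
  assumes "s2 n > 0" "\<And>i. 0 \<le> p i" "p n > 0" "h n n \<noteq> 0"
  obtains x r where "r > 0"
    "eigenvector (matrix_inv (Omega_minus h s2 p n) ** Omega h p n) x (of_real r)"
proof -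
  let ?A = "Omega_minus h s2 p n" and ?g = "h n n"
  have inv: "invertible ?A"
    using assms by (intro invertible_Omega_minus)
  define x where "x = matrix_inv ?A *v ?g"
  have Ax: "?A *v x = ?g"
    using matrix_inv_inverse(1)[OF inv] by (simp add: x_def matrix_vector_mul_assoc)
  have "x \<noteq> 0"
    using Ax assms by auto
  have "herm_prod ?g x = of_real (interference h s2 p n x)"
    using Omega_minus_diag[of x h s2 p n] cnj_herm_prod[of x ?g] by (simp add: Ax)
  then have "eigenvector (matrix_inv ?A ** Omega h p n) x (of_real (p n * interference h s2 p n x))"
    using \<open>x \<noteq> 0\<close> by (simp add: eigenvector_Omega_iff[OF inv] Ax)
  moreover have "p n * interference h s2 p n x > 0"
    using assms \<open>x \<noteq> 0\<close> by (intro mult_pos_pos interference_pos)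
  ultimately show ?thesis
    using that by blast
qed

text \<open>Every eigenvalue is the SINR of its eigenvector, hence bounded by the positive
  eigenvalue already found.\<close>

lemma ex_principal_eigenvector:
  assumes "s2 n > 0" "\<And>i. 0 \<le> p i" "p n > 0" "h n n \<noteq> 0"
  shows "\<exists>v. principal_eigenvector (matrix_inv (Omega_minus h s2 p n) ** Omega h p n) v"
proof -
  obtain x r where "r > 0"
    and x: "eigenvector (matrix_inv (Omega_minus h s2 p n) ** Omega h p n) x (of_real r)"
    using ex_positive_eigenvalue[of s2 n p h] assms by blast
  have "k \<in> \<real> \<and> Re k \<le> r"
    if "eigenvector (matrix_inv (Omega_minus h s2 p n) ** Omega h p n) w k" for w k
  proof -
    have "w \<noteq> 0" using that by (simp add: eigenvector_def)
    then show ?thesis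
      using eigenvalue_eq_sinr[OF assms(1,2) that] sinr_le_eigenvalue[OF assms(1,2) _ \<open>r > 0\<close> x] by simp
  qed
  then show ?thesis
    using x unfolding principal_eigenvector_def largest_eigenvalue_def eigenvalue_def by blast
qed

lemma principal_eigenvector_maximizes_sinr:
  assumes "s2 n > 0" "\<And>i. 0 \<le> p i" "p n > 0" "h n n \<noteq> 0" "v \<noteq> 0"
    and w: "principal_eigenvector (matrix_inv (Omega_minus h s2 p n) ** Omega h p n) w"
  shows "sinr h s2 p n v \<le> sinr h s2 p n w"
proof -
  obtain r where r: "largest_eigenvalue (matrix_inv (Omega_minus h s2 p n) ** Omega h p n) r"
    and ev: "eigenvector (matrix_inv (Omega_minus h s2 p n) ** Omega h p n) w (of_real r)"
    using w by (auto simp: principal_eigenvector_def)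
  obtain x r' where "r' > 0"
    "eigenvector (matrix_inv (Omega_minus h s2 p n) ** Omega h p n) x (of_real r')"
    using ex_positive_eigenvalue[of s2 n p h] assms by blast
  \<comment> \<open>The largest eigenvalue dominates \<open>r'\<close>; this excludes
    \<open>r = 0\<close>, where the Cauchy-Schwarz argument would give no bound.\<close>
  then have "r > 0"
    using r unfolding largest_eigenvalue_def eigenvalue_def by fastforce
  have "r = sinr h s2 p n w"
    using eigenvalue_eq_sinr[OF assms(1,2) ev] of_real_eq_iff by blast
  then show ?thesis
    using sinr_le_eigenvalue[OF assms(1,2,5) \<open>r > 0\<close> ev] by simp
qed

section \<open>From SINR to latency and optimality\<close>

lemma sinr_nonneg:
  assumes "s2 n > 0" "\<And>i. 0 \<le> p i"
  shows "0 \<le> sinr h s2 p n v"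
  unfolding sinr_def using assms by (intro divide_nonneg_nonneg add_nonneg_nonneg sum_nonneg) auto

text \<open>A zero rate at \<open>v\<close> means infinite latency, a trivial bound; otherwise both
  rates are positive and ordered.\<close>

lemma latency_antimono:
  assumes "B > 0" "D n > 0" "0 \<le> sinr h s2 p n v" "sinr h s2 p n v \<le> sinr h s2 p n w"
  shows "latency B D h s2 p n w \<le> latency B D h s2 p n v"
proof (cases "rate B h s2 p n v = 0")
  case False
  then have "0 < rate B h s2 p n v"
    using assms by (simp add: rate_def zero_less_mult_iff order_less_le)
  moreover have "rate B h s2 p n v \<le> rate B h s2 p n w"
    using assms by (simp add: rate_def)
  ultimately show ?thesis
    using assms by (simp add: latency_def frac_le)
qed (simp add: latency_def)

text \<open>The first conjunct keeps the optimality claim from being vacuous: the inverses are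
  genuine and the required eigenvectors exist.\<close>

theorem lemma1:
  fixes h :: "'n::finite \<Rightarrow> 'n \<Rightarrow> complex ^ 'l::finite"
    and B Pmax Tth :: real
    and D s2 Tedge c p :: "'n \<Rightarrow> real"
  assumes "B > 0" and "Pmax > 0" and "Tth > 0"
    and "\<And>n. D n > 0" and "\<And>n. s2 n > 0" and "\<And>n. Tedge n > 0"
    and "\<And>n. 0 \<le> c n \<and> c n \<le> 1"
    and "\<And>n. 0 \<le> p n \<and> p n \<le> Pmax"
    and "\<exists>w. feasible B D h s2 c Tedge Tth p w"
  shows "(\<forall>n. invertible (Omega_minus h s2 p n) \<and>
              (\<exists>v. principal_eigenvector (matrix_inv (Omega_minus h s2 p n) ** Omega h p n) v)) \<and>
         (\<forall>w. (\<forall>n. principal_eigenvector (matrix_inv (Omega_minus h s2 p n) ** Omega h p n) (w n))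
              \<longrightarrow> optimal B D h s2 c Tedge Tth p w)"
proof -
  obtain w0 where w0: "feasible B D h s2 c Tedge Tth p w0"
    using assms by blast
  have p0: "0 \<le> p i" for i
    using assms(8) by blast
  \<comment> \<open>Zero SINR means zero rate, so infinite latency, which violates the
    constraint.\<close>
  have nz: "sinr h s2 p n (w0 n) \<noteq> 0" for n
    using w0 unfolding feasible_def latency_def rate_def by (auto dest!: spec[of _ n])
  then have pn: "p n > 0" and hn: "h n n \<noteq> 0" for n
    using p0[of n] nz[of n] by (force simp: sinr_def order_less_le)+
  have opt: "optimal B D h s2 c Tedge Tth p w"
    if w: "\<And>n. principal_eigenvector (matrix_inv (Omega_minus h s2 p n) ** Omega h p n) (w n)" for w
  proof -
    \<comment> \<open>This userwise comparison serves twice: with \<open>w0\<close> it gives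
      feasibility of \<open>w\<close>, with any feasible \<open>w'\<close> it gives optimality, the
      weights \<open>p n\<close> being nonnegative.\<close>
    have le: "latency B D h s2 p n (w n) \<le> latency B D h s2 p n (w' n)"
      if "feasible B D h s2 c Tedge Tth p w'" for w' n
    proof -
      have "w' n \<noteq> 0" using that by (simp add: feasible_def)
      then show ?thesis
        using assms p0 pn hn w
        by (intro latency_antimono principal_eigenvector_maximizes_sinr sinr_nonneg) auto
    qed
    have "w n \<noteq> 0" for n
      using w[of n] by (auto simp: principal_eigenvector_def eigenvector_def)
    moreover have "latency B D h s2 p n (w n) + ereal (c n * Tedge n) \<le> ereal Tth" for n
      using le[OF w0, of n] w0 unfolding feasible_def by (meson add_right_mono order_trans)
    ultimately have "feasible B D h s2 c Tedge Tth p w"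
      by (simp add: feasible_def)
    moreover have "energy B D h s2 p w \<le> energy B D h s2 p w'"
      if "feasible B D h s2 c Tedge Tth p w'" for w'
      unfolding energy_def using le[OF that] p0 by (intro sum_mono ereal_mult_left_mono) auto
    ultimately show ?thesis
      by (simp add: optimal_def)
  qed
  show ?thesis
    using opt assms(5) p0 pn hn
    by (auto intro!: invertible_Omega_minus ex_principal_eigenvector)
qed

end
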